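(* Let $M_3$ be the Turing machine with states $A,B,C$ (plus halting state $H$) and the 10 symbols $b,1,x,r,u,v,y,z,t,k$ defined in the context. The $3x+1$ conjecture is true if and only if, for all positive integers $n$, the Turing machine $M_3$ halts on the initial configuration ${}^\omega b(A1)1^{n-1}b^\omega$.
   Context: The $3x+1$ function $T$ on positive integers is $T(m)=m/2$ if $m$ is even and $T(m)=(3m+1)/2$ if $m$ is odd. The $3x+1$ conjecture is the assertion that, when $T$ is iterated from any positive integer, the loop $2\mapsto 1\mapsto 2$ is always reached (i.e. for every positive integer $m$ some iterate $T^j(m)$, $j\ge 0$, lies in $\{1,2\}$; equivalently some iterate equals $1$). Turing machines have one tape, infinite on both sides, made of cells containing symbols, one read/write head, a set $Q$ of states plus a halting state $H$, a set $\Sigma$ of symbols containing a blank symbol $b$, and a next move function $\delta$. If $\delta(p,a)=(a',D,q)$ then the machine, reading symbol $a$ in state $p$, replaces $a$ by $a'$, moves one cell in direction $D\in\{L,R\}$ ($L$ = left, $R$ = right), and enters state $q$. The machine halts when it enters state $H$. The configuration ${}^\omega b(A1)1^{n-1}b^\omega$ is the one in which the word $1^n$ is written on the tape between two infinite strings of blanks, the machine is in state $A$, and the head is on the leftmost $1$. The machine $M_3$ has $Q=\{A,B,C\}$, $\Sigma=\{b,1,x,r,u,v,y,z,t,k\}$ (blank $b$), and the following transitions, where "$a'Dq$" in row $p$ and column $a$ means $\delta(p,a)=(a',D,q)$; pairs (state, symbol) not listed have no transition defined (and reaching such a pair does not count as halting): Row $A$: on $b$: $bRA$; on $1$: $xRC$;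 on $x$: $1LA$; on $r$: $kRB$; on $u$: $xRA$; on $v$: $xRA$; on $y$: $rLA$; on $z$: $rLA$; on $t$: $yRA$. Row $B$: on $b$: $zLB$; on $1$: $uRB$; on $x$: $xRB$; on $r$: $yRB$; on $u$: $vLB$; on $v$: $uRA$; on $y$: $tLB$; on $z$: $1LA$; on $t$: $xRB$; on $k$: $bRB$. Row $C$: on $b$: $bLH$; on $1$: $uRB$; on $r$: $yRB$. *)

theory Defs
  imports Complex_Main
begin

definition T :: "nat \<Rightarrow> nat" where
  "T m = (if even m then m div 2 else (3 * m + 1) div 2)"

definition three_x_plus_one_conjecture :: bool where
  "three_x_plus_one_conjecture \<longleftrightarrow> (\<forall>m>0. \<exists>j. (T ^^ j) m \<in> {1, 2})"

datatype direction = Move_L | Move_R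

text \<open>
  A machine is its (partial) next move function; \<open>\<delta> p a = Some (a', D, q)\<close> means: write \<open>a'\<close>,
  move in direction \<open>D\<close>, enter \<open>q\<close>. The halting state is an element of the state type for which
  \<open>\<delta>\<close> is undefined. Tape cells are indexed by the integers.
\<close>

type_synonym ('q, 's) machine = "'q \<Rightarrow> 's \<Rightarrow> ('s \<times> direction \<times> 'q) option"

datatype ('q, 's) config =
  Config (config_state: 'q) (config_head: int) (config_tape: "int \<Rightarrow> 's")

fun move :: "direction \<Rightarrow> int \<Rightarrow> int" where
  "move Move_L i = i - 1"
| "move Move_R i = i + 1"

inductive step :: "('q, 's) machine \<Rightarrow> ('q, 's) config \<Rightarrow> ('q, 's) config \<Rightarrow> bool"
  for \<delta> :: "('q, 's) machine" where
  "\<delta> p (tp i) = Some (a, D, q) \<Longrightarrow> step \<delta> (Config p i tp) (Config q (move D i) (tp(i := a)))"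

text \<open>
  Halting means entering the state \<open>h\<close>; a configuration in another state with no applicable
  transition is stuck, but not halted.
\<close>

definition halts_on :: "('q, 's) machine \<Rightarrow> 'q \<Rightarrow> ('q, 's) config \<Rightarrow> bool" where
  "halts_on \<delta> h c \<longleftrightarrow> (\<exists>c'. (step \<delta>)\<^sup>*\<^sup>* c c' \<and> config_state c' = h)"

datatype state = Q_A | Q_B | Q_C | Q_H

datatype symbol = S_b | S_1 | S_x | S_r | S_u | S_v | S_y | S_z | S_t | S_k

fun M3 :: "(state, symbol) machine" where
  "M3 Q_A S_b = Some (S_b, Move_R, Q_A)"
| "M3 Q_A S_1 = Some (S_x, Move_R, Q_C)"
| "M3 Q_A S_x = Some (S_1, Move_L, Q_A)"
| "M3 Q_A S_r = Some (S_k, Move_R, Q_B)"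
| "M3 Q_A S_u = Some (S_x, Move_R, Q_A)"
| "M3 Q_A S_v = Some (S_x, Move_R, Q_A)"
| "M3 Q_A S_y = Some (S_r, Move_L, Q_A)"
| "M3 Q_A S_z = Some (S_r, Move_L, Q_A)"
| "M3 Q_A S_t = Some (S_y, Move_R, Q_A)"
| "M3 Q_B S_b = Some (S_z, Move_L, Q_B)"
| "M3 Q_B S_1 = Some (S_u, Move_R, Q_B)"
| "M3 Q_B S_x = Some (S_x, Move_R, Q_B)"
| "M3 Q_B S_r = Some (S_y, Move_R, Q_B)"
| "M3 Q_B S_u = Some (S_v, Move_L, Q_B)"
| "M3 Q_B S_v = Some (S_u, Move_R, Q_A)"
| "M3 Q_B S_y = Some (S_t, Move_L, Q_B)"
| "M3 Q_B S_z = Some (S_1, Move_L, Q_A)"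
| "M3 Q_B S_t = Some (S_x, Move_R, Q_B)"
| "M3 Q_B S_k = Some (S_b, Move_R, Q_B)"
| "M3 Q_C S_b = Some (S_b, Move_L, Q_H)"
| "M3 Q_C S_1 = Some (S_u, Move_R, Q_B)"
| "M3 Q_C S_r = Some (S_y, Move_R, Q_B)"
| "M3 _ _ = None"

definition initial_config :: "nat \<Rightarrow> (state, symbol) config" where
  "initial_config n = Config Q_A 0 (\<lambda>i. if 0 \<le> i \<and> i < int n then S_1 else S_b)"

end

theory Submission
  imports Defs
begin

text \<open>
  The machine applies \<^const>\<open>T\<close> to a block \<open>1\<^sup>n\<close> that has a blank immediately to its left and only
  blanks to its right. It divides the block by two in rounds: one round turns the part
  \<open>1\<^sup>m\<^sup>+\<^sup>2 r\<^sup>j\<close> to the right of the head into \<open>x x 1\<^sup>m r\<^sup>j\<^sup>+\<^sup>1\<close>, so two \<open>1\<close>s are consumed and one \<open>r\<close> is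
  produced (\<open>rounds\<close>). After \<open>k\<close> rounds a block of length \<open>2k\<close> has become \<open>x\<^sup>2\<^sup>k r\<^sup>k\<close>;
  the machine then puts a blank in front of \<open>k\<close> fresh \<open>1\<close>s and abandons the \<open>x\<close>s to the left of that
  blank (\<open>finish_even\<close>). A block of length \<open>2k + 1\<close>
  has become \<open>x\<^sup>2\<^sup>k 1 r\<^sup>k\<close>; the machine then extends it by one cell and rewrites everything back to
  the separating blank as \<open>1\<close>s, which gives \<open>2k + 1 + k + 1 = 3k + 2\<close> of them (\<open>finish_odd\<close>). In both
  cases the result is a block of length \<open>T n\<close> of the same kind. Only the block of
  length \<open>1\<close> is different: the machine meets a blank in state \<open>C\<close> and halts.

  Hence reaching \<open>1\<close> under \<^const>\<open>T\<close> implies halting. For the converse, the machine is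
  deterministic, so a halting run from \<open>1\<^sup>n\<close> has to pass through the blocks of length \<open>n\<close>, \<open>T n\<close>,
  \<open>T (T n)\<close>, and so on, each reached after at least one further step. As the run is finite, this
  cannot go on forever, and a block of length \<open>1\<close> is the only way to break the pattern.
\<close>

section \<open>Configurations as pairs of words\<close>

text \<open>
  A word configuration \<open>(p, ls, rs)\<close> forgets the absolute head position: \<open>ls\<close> lists the cells to the
  left of the head, nearest first, and \<open>rs\<close> the cells from the head on to the right. Both words are
  continued by blanks, so that every step is a manipulation of the two words near the head.
\<close>

type_synonym word_config = "state \<times> symbol list \<times> symbol list"

definition blank_padded :: "symbol list \<Rightarrow> nat \<Rightarrow> symbol" where
  "blank_padded xs n = (if n < length xs then xs ! n else S_b)"

fun place :: "int \<Rightarrow> word_config \<Rightarrow> (state, symbol) config" where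
  "place i (p, ls, rs) =
    Config p i (\<lambda>k. if k < i then blank_padded ls (nat (i - 1 - k)) else blank_padded rs (nat (k - i)))"

fun scanned :: "symbol list \<Rightarrow> symbol" where
  "scanned [] = S_b"
| "scanned (a # rs) = a"

text \<open>
  In \<open>leftwards p ls rs\<close> the head is on the first cell of \<open>ls\<close>. This is the natural form of a
  configuration during a sweep to the left, where the symbols still to be read lie in the left word.
\<close>

fun leftwards :: "state \<Rightarrow> symbol list \<Rightarrow> symbol list \<Rightarrow> word_config" where
  "leftwards p [] rs = (p, [], S_b # rs)"
| "leftwards p (c # ls) rs = (p, ls, c # rs)"

inductive word_step :: "word_config \<Rightarrow> word_config \<Rightarrow> bool" where
  right: "M3 p (scanned rs) = Some (a, Move_R, q) \<Longrightarrow> word_step (p, ls, rs) (q, a # ls, tl rs)"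
| left: "M3 p (scanned rs) = Some (a, Move_L, q) \<Longrightarrow>
    word_step (p, ls, rs) (leftwards q ls (a # tl rs))"

abbreviation word_steps :: "word_config \<Rightarrow> word_config \<Rightarrow> bool"  (infix "\<leadsto>" 50) where
  "c \<leadsto> d \<equiv> word_step\<^sup>*\<^sup>* c d"

lemma blank_padded_Nil [simp]: "blank_padded [] n = S_b"
  by (simp add: blank_padded_def)

lemma blank_padded_Cons: "blank_padded (a # xs) n = (if n = 0 then a else blank_padded xs (n - 1))"
  by (cases n) (auto simp: blank_padded_def)

lemma blank_padded_0: "blank_padded xs 0 = scanned xs"
  by (cases xs) (auto simp: blank_padded_def)

lemma blank_padded_tl: "blank_padded (tl xs) n = blank_padded xs (Suc n)"
  by (cases xs) (auto simp: blank_padded_def)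

lemma place_right:
  assumes "place i (p, ls, rs) = Config p i tp"
  shows "place (i + 1) (q, a # ls, tl rs) = Config q (i + 1) (tp(i := a))"
proof -
  have "(if k < i + 1 then blank_padded (a # ls) (nat (i + 1 - 1 - k))
      else blank_padded (tl rs) (nat (k - (i + 1)))) = (tp(i := a)) k" for k
  proof -
    have "Suc (nat (k - (i + 1))) = nat (k - i)" if "k > i"
      using that by linarith
    moreover have "nat (i - k) - 1 = nat (i - 1 - k)"
      by linarith
    ultimately show ?thesis
      using assms by (auto simp: blank_padded_Cons blank_padded_tl)
  qed
  then show ?thesis by (simp add: fun_eq_iff)
qed

lemma place_left:
  assumes "place i (p, ls, rs) = Config p i tp"
  shows "place (i - 1) (leftwards q ls (a # tl rs)) = Config q (i - 1) (tp(i := a))"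
proof -
  have leftwards: "leftwards q ls (a # tl rs) = (q, tl ls, scanned ls # a # tl rs)"
    by (cases ls) auto
  have "(if k < i - 1 then blank_padded (tl ls) (nat (i - 1 - 1 - k))
      else blank_padded (scanned ls # a # tl rs) (nat (k - (i - 1)))) = (tp(i := a)) k" for k
  proof -
    consider "k < i - 1" | "k = i - 1" | "k = i" | "k > i" by linarith
    then show ?thesis
    proof cases
      case 1
      then have "Suc (nat (i - 1 - 1 - k)) = nat (i - 1 - k)" by linarith
      with 1 assms show ?thesis by (auto simp: blank_padded_tl)
    next
      case 4
      then have "nat (k - (i - 1)) = Suc (Suc (nat (k - i - 1)))" "nat (k - i) = Suc (nat (k - i - 1))"
        by linarith+
      with 4 assms show ?thesis by (auto simp: blank_padded_Cons blank_padded_tl)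
    qed (use assms in \<open>auto simp: blank_padded_Cons blank_padded_0\<close>)
  qed
  then show ?thesis unfolding leftwards by (simp add: fun_eq_iff)
qed

lemma step_if_word_step:
  assumes "word_step c d"
  shows "\<exists>j. step M3 (place i c) (place j d)"
  using assms
proof cases
  case (right p rs a q ls)
  obtain tp where tp: "place i (p, ls, rs) = Config p i tp" by simp
  then have "tp i = scanned rs" by (auto simp: blank_padded_0)
  with right have "step M3 (Config p i tp) (Config q (move Move_R i) (tp(i := a)))"
    by (intro step.intros) simp
  with right tp place_right[OF tp, of q a] show ?thesis
    by (metis move.simps(2))
next
  case (left p rs a q ls)
  obtain tp where tp: "place i (p, ls, rs) = Config p i tp" by simp
  then have "tp i = scanned rs" by (auto simp: blank_padded_0)
  with left have "step M3 (Config p i tp) (Config q (move Move_L i) (tp(i := a)))"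
    by (intro step.intros) simp
  with left tp place_left[OF tp, of q a] show ?thesis
    by (metis move.simps(1))
qed

lemma steps_if_word_steps:
  assumes "c \<leadsto> d"
  shows "\<exists>j. (step M3)\<^sup>*\<^sup>* (place i c) (place j d)"
  using assms
proof (induction rule: rtranclp_induct)
  case (step d e)
  then show ?case by (meson rtranclp.rtrancl_into_rtrancl step_if_word_step)
qed blast

lemma proper_steps_if_proper_word_steps:
  assumes "word_step\<^sup>+\<^sup>+ c d"
  shows "\<exists>j. (step M3)\<^sup>+\<^sup>+ (place i c) (place j d)"
proof -
  from assms obtain c' where "word_step c c'" "c' \<leadsto> d"
    by (meson tranclpD)
  then show ?thesis
    by (meson rtranclp_into_tranclp2 step_if_word_step steps_if_word_steps)
qed

section \<open>Sweeps over a constant stretch of tape\<close>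

lemma move_right:
  assumes "M3 p a = Some (a', Move_R, q)"
  shows "(p, ls, a # rs) \<leadsto> (q, a' # ls, rs)"
  using word_step.right[of p "a # rs"] assms by auto

lemma move_left:
  assumes "M3 p a = Some (a', Move_L, q)"
  shows "(p, ls, a # rs) \<leadsto> leftwards q ls (a' # rs)"
  using word_step.left[of p "a # rs"] assms by auto

lemma move_left_at_end:
  assumes "M3 p S_b = Some (a', Move_L, q)"
  shows "(p, ls, []) \<leadsto> leftwards q ls [a']"
  using word_step.left[of p "[]"] assms by auto

lemma sweep_right:
  assumes "M3 p a = Some (a', Move_R, p)"
  shows "(p, ls, replicate n a @ rs) \<leadsto> (p, replicate n a' @ ls, rs)"
proof (induction n arbitrary: ls)
  case (Suc n)
  have "(p, ls, replicate (Suc n) a @ rs) \<leadsto> (p, a' # ls, replicate n a @ rs)"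
    using move_right[OF assms] by simp
  also have "\<dots> \<leadsto> (p, replicate n a' @ a' # ls, rs)"
    by (rule Suc.IH)
  finally show ?case
    by (simp add: replicate_app_Cons_same)
qed simp

lemma sweep_left:
  assumes "M3 p a = Some (a', Move_L, p)"
  shows "leftwards p (replicate n a @ ls) rs \<leadsto> leftwards p ls (replicate n a' @ rs)"
proof (induction n arbitrary: rs)
  case (Suc n)
  have "leftwards p (replicate (Suc n) a @ ls) rs \<leadsto> leftwards p (replicate n a @ ls) (a' # rs)"
    using move_left[OF assms] by simp
  also have "\<dots> \<leadsto> leftwards p ls (replicate n a' @ a' # rs)"
    by (rule Suc.IH)
  finally show ?case
    by (simp add: replicate_app_Cons_same)
qed simp

section \<open>One application of T\<close>

abbreviation (input) rep :: "symbol \<Rightarrow> nat \<Rightarrow> symbol list"  (infix "\<^bold>^" 80) where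
  "a \<^bold>^ n \<equiv> replicate n a"

text \<open>
  The machine marks the first two \<open>1\<close>s by \<open>x u\<close> and then sweeps four times between this mark and
  the first blank. Along the way the other \<open>1\<close>s become \<open>u\<close>, \<open>v\<close>, \<open>x\<close> and again \<open>1\<close>, the \<open>r\<close>s become
  \<open>y\<close>, \<open>t\<close>, \<open>y\<close> and again \<open>r\<close>, and the blank becomes \<open>z\<close> and then the new \<open>r\<close>. The second sweep turns
  the mark \<open>u\<close> into a \<open>v\<close> too and is stopped by the \<open>x\<close> before it; the third one restores the \<open>u\<close>,
  which stops the fourth.
\<close>

lemma round:
  "(Q_A, ls, S_1 \<^bold>^ (m + 2) @ S_r \<^bold>^ j) \<leadsto> (Q_A, S_x \<^bold>^ 2 @ ls, S_1 \<^bold>^ m @ S_r \<^bold>^ (j + 1))"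
proof -
  have "(Q_A, ls, S_1 \<^bold>^ (m + 2) @ S_r \<^bold>^ j) \<leadsto> (Q_C, S_x # ls, S_1 # S_1 \<^bold>^ m @ S_r \<^bold>^ j)"
    using move_right[of Q_A S_1] by simp
  also have "\<dots> \<leadsto> (Q_B, S_u # S_x # ls, S_1 \<^bold>^ m @ S_r \<^bold>^ j)"
    by (rule move_right) simp
  also have "\<dots> \<leadsto> (Q_B, S_u \<^bold>^ m @ S_u # S_x # ls, S_r \<^bold>^ j @ [])"
    using sweep_right[of Q_B S_1 S_u] by simp
  also have "\<dots> \<leadsto> (Q_B, S_y \<^bold>^ j @ S_u \<^bold>^ m @ S_u # S_x # ls, [])"
    by (rule sweep_right) simp
  also have "\<dots> \<leadsto> leftwards Q_B (S_y \<^bold>^ j @ S_u \<^bold>^ m @ S_u # S_x # ls) [S_z]"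
    by (rule move_left_at_end) simp
  also have "\<dots> \<leadsto> leftwards Q_B (S_u \<^bold>^ m @ S_u # S_x # ls) (S_t \<^bold>^ j @ [S_z])"
    by (rule sweep_left) simp
  also have "\<dots> \<leadsto> leftwards Q_B (S_x # ls) (S_v # S_v \<^bold>^ m @ S_t \<^bold>^ j @ [S_z])"
    using sweep_left[of Q_B S_u S_v "Suc m" "S_x # ls"] by (simp add: replicate_app_Cons_same)
  also have "\<dots> \<leadsto> (Q_B, S_x # ls, S_v # S_v \<^bold>^ m @ S_t \<^bold>^ j @ [S_z])"
    using move_right[of Q_B S_x] by simp
  also have "\<dots> \<leadsto> (Q_A, S_u # S_x # ls, S_v \<^bold>^ m @ S_t \<^bold>^ j @ [S_z])"
    by (rule move_right) simp
  also have "\<dots> \<leadsto> (Q_A, S_x \<^bold>^ m @ S_u # S_x # ls, S_t \<^bold>^ j @ [S_z])"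
    by (rule sweep_right) simp
  also have "\<dots> \<leadsto> (Q_A, S_y \<^bold>^ j @ S_x \<^bold>^ m @ S_u # S_x # ls, [S_z])"
    by (rule sweep_right) simp
  also have "\<dots> \<leadsto> leftwards Q_A (S_y \<^bold>^ j @ S_x \<^bold>^ m @ S_u # S_x # ls) [S_r]"
    by (rule move_left) simp
  also have "\<dots> \<leadsto> leftwards Q_A (S_x \<^bold>^ m @ S_u # S_x # ls) (S_r \<^bold>^ j @ [S_r])"
    by (rule sweep_left) simp
  also have "\<dots> \<leadsto> leftwards Q_A (S_u # S_x # ls) (S_1 \<^bold>^ m @ S_r \<^bold>^ j @ [S_r])"
    by (rule sweep_left) simp
  also have "\<dots> \<leadsto> (Q_A, S_x # S_x # ls, S_1 \<^bold>^ m @ S_r \<^bold>^ j @ [S_r])"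
    using move_right[of Q_A S_u] by simp
  finally show ?thesis
    by (simp add: numeral_2_eq_2 replicate_append_same)
qed

lemma rounds:
  "(Q_A, ls, S_1 \<^bold>^ (2 * k + m)) \<leadsto> (Q_A, S_x \<^bold>^ (2 * k) @ ls, S_1 \<^bold>^ m @ S_r \<^bold>^ k)"
proof (induction k arbitrary: m)
  case (Suc k)
  have "(Q_A, ls, S_1 \<^bold>^ (2 * Suc k + m)) = (Q_A, ls, S_1 \<^bold>^ (2 * k + (m + 2)))"
    by (simp add: algebra_simps)
  also have "\<dots> \<leadsto> (Q_A, S_x \<^bold>^ (2 * k) @ ls, S_1 \<^bold>^ (m + 2) @ S_r \<^bold>^ k)"
    by (rule Suc.IH)
  also have "\<dots> \<leadsto> (Q_A, S_x \<^bold>^ 2 @ S_x \<^bold>^ (2 * k) @ ls, S_1 \<^bold>^ m @ S_r \<^bold>^ (k + 1))"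
    by (rule round)
  also have "\<dots> = (Q_A, S_x \<^bold>^ (2 * Suc k) @ ls, S_1 \<^bold>^ m @ S_r \<^bold>^ Suc k)"
    by (simp add: numeral_2_eq_2)
  finally show ?case .
qed simp

text \<open>
  The first \<open>r\<close> becomes the symbol \<^const>\<open>S_k\<close> and finally the new separating blank, and the blank to the right
  of the \<open>r\<close>s becomes a \<open>1\<close>, so the number of \<open>1\<close>s is the number of \<open>r\<close>s.
\<close>

lemma finish_even:
  "(Q_A, ls, S_r \<^bold>^ Suc j) \<leadsto> (Q_A, S_b # ls, S_1 \<^bold>^ Suc j)"
proof -
  have "(Q_A, ls, S_r \<^bold>^ Suc j) \<leadsto> (Q_B, S_k # ls, S_r \<^bold>^ j @ [])"
    using move_right[of Q_A S_r] by simp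
  also have "\<dots> \<leadsto> (Q_B, S_y \<^bold>^ j @ S_k # ls, [])"
    by (rule sweep_right) simp
  also have "\<dots> \<leadsto> leftwards Q_B (S_y \<^bold>^ j @ S_k # ls) [S_z]"
    by (rule move_left_at_end) simp
  also have "\<dots> \<leadsto> leftwards Q_B (S_k # ls) (S_t \<^bold>^ j @ [S_z])"
    by (rule sweep_left) simp
  also have "\<dots> \<leadsto> (Q_B, S_b # ls, S_t \<^bold>^ j @ [S_z])"
    using move_right[of Q_B S_k] by simp
  also have "\<dots> \<leadsto> (Q_B, S_x \<^bold>^ j @ S_b # ls, [S_z])"
    by (rule sweep_right) simp
  also have "\<dots> \<leadsto> leftwards Q_A (S_x \<^bold>^ j @ S_b # ls) [S_1]"
    by (rule move_left) simp
  also have "\<dots> \<leadsto> leftwards Q_A (S_b # ls) (S_1 \<^bold>^ j @ [S_1])"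
    by (rule sweep_left) simp
  also have "\<dots> \<leadsto> (Q_A, S_b # ls, S_1 \<^bold>^ j @ [S_1])"
    using move_right[of Q_A S_b] by simp
  finally show ?thesis
    by (simp add: replicate_append_same)
qed

text \<open>
  All of the \<open>i\<close> cells \<open>x\<close>, the single \<open>1\<close>, the \<open>r\<close>s and one blank end up as \<open>1\<close>s: the last
  sweep to the left runs over all the \<open>x\<close>s, and it is stopped only by the blank in front of them.
\<close>

lemma finish_odd:
  "(Q_A, S_x \<^bold>^ i @ S_b # ls, S_1 # S_r \<^bold>^ Suc j) \<leadsto> (Q_A, S_b # ls, S_1 \<^bold>^ (i + j + 3))"
proof -
  let ?ls = "S_x \<^bold>^ i @ S_b # ls"
  have "(Q_A, ?ls, S_1 # S_r \<^bold>^ Suc j) \<leadsto> (Q_C, S_x # ?ls, S_r # S_r \<^bold>^ j)"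
    using move_right[of Q_A S_1] by simp
  also have "\<dots> \<leadsto> (Q_B, S_y # S_x # ?ls, S_r \<^bold>^ j @ [])"
    using move_right[of Q_C S_r] by simp
  also have "\<dots> \<leadsto> (Q_B, S_y \<^bold>^ j @ S_y # S_x # ?ls, [])"
    by (rule sweep_right) simp
  also have "\<dots> \<leadsto> leftwards Q_B (S_y \<^bold>^ j @ S_y # S_x # ?ls) [S_z]"
    by (rule move_left_at_end) simp
  also have "\<dots> \<leadsto> leftwards Q_B (S_x # ?ls) (S_t \<^bold>^ Suc j @ [S_z])"
    using sweep_left[of Q_B S_y S_t "Suc j" "S_x # ?ls"] by (simp add: replicate_app_Cons_same)
  also have "\<dots> \<leadsto> (Q_B, S_x # ?ls, S_t \<^bold>^ Suc j @ [S_z])"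
    using move_right[of Q_B S_x] by simp
  also have "\<dots> \<leadsto> (Q_B, S_x \<^bold>^ Suc j @ S_x # ?ls, [S_z])"
    by (rule sweep_right) simp
  also have "\<dots> \<leadsto> leftwards Q_A (S_x \<^bold>^ Suc j @ S_x # ?ls) [S_1]"
    by (rule move_left) simp
  also have "S_x \<^bold>^ Suc j @ S_x # ?ls = S_x \<^bold>^ (i + j + 2) @ S_b # ls"
    by (simp add: replicate_add[symmetric] replicate_app_Cons_same add.commute flip: append_assoc)
  also have "leftwards Q_A \<dots> [S_1] \<leadsto> leftwards Q_A (S_b # ls) (S_1 \<^bold>^ (i + j + 2) @ [S_1])"
    by (rule sweep_left) simp
  also have "\<dots> \<leadsto> (Q_A, S_b # ls, S_1 \<^bold>^ (i + j + 2) @ [S_1])"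
    using move_right[of Q_A S_b] by simp
  finally show ?thesis
    by (simp add: replicate_append_same numeral_3_eq_3)
qed

abbreviation block :: "nat \<Rightarrow> symbol list \<Rightarrow> word_config" where
  "block n ls \<equiv> (Q_A, S_b # ls, S_1 \<^bold>^ n)"

lemma block_T:
  assumes "n \<ge> 2"
  shows "\<exists>ls'. word_step\<^sup>+\<^sup>+ (block n ls) (block (T n) ls')"
proof -
  define k where "k = n div 2 - 1"
  have n: "n = 2 * Suc k + n mod 2"
    using assms unfolding k_def by presburger
  (* At least one round takes place, since it changes the left word. *)
  have "word_step\<^sup>+\<^sup>+ (block n ls) (Q_A, S_x \<^bold>^ (2 * Suc k) @ S_b # ls, S_1 \<^bold>^ (n mod 2) @ S_r \<^bold>^ Suc k)"
    using rtranclpD[OF rounds[of "S_b # ls" "Suc k" "n mod 2", folded n]] by simp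
  also have "\<exists>ls'. (Q_A, S_x \<^bold>^ (2 * Suc k) @ S_b # ls, S_1 \<^bold>^ (n mod 2) @ S_r \<^bold>^ Suc k)
      \<leadsto> block (T n) ls'"
  proof (cases "even n")
    case True
    then have "T n = Suc k" "n mod 2 = 0"
      using n by (auto simp: T_def)
    then show ?thesis
      using finish_even[of "S_x \<^bold>^ (2 * Suc k) @ S_b # ls" k] by auto
  next
    case False
    then have "T n = 2 * Suc k + k + 3" "n mod 2 = 1"
      using n by (auto simp: T_def odd_iff_mod_2_eq_one)
    then show ?thesis
      using finish_odd[of "2 * Suc k" ls k] by auto
  qed
  then obtain ls' where "(Q_A, S_x \<^bold>^ (2 * Suc k) @ S_b # ls, S_1 \<^bold>^ (n mod 2) @ S_r \<^bold>^ Suc k)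
      \<leadsto> block (T n) ls'" ..
  finally show ?thesis ..
qed

section \<open>Halting\<close>

lemma step_deterministic:
  assumes "step \<delta> c d" "step \<delta> c e"
  shows "d = e"
  using assms by (auto elim!: step.cases)

lemma halted_is_final: "config_state c = Q_H \<Longrightarrow> \<not> step M3 c d"
  by (auto elim!: step.cases)

lemma halts_on_block_1: "halts_on M3 Q_H (place i (block 1 ls))"
proof -
  have "block 1 ls \<leadsto> (Q_C, S_x # S_b # ls, [])"
    using move_right[of Q_A S_1] by simp
  also have "\<dots> \<leadsto> (Q_H, S_b # ls, [S_x, S_b])"
    using move_left_at_end[of Q_C S_b Q_H "S_x # S_b # ls"] by simp
  finally obtain j where "(step M3)\<^sup>*\<^sup>* (place i (block 1 ls)) (place j (Q_H, S_b # ls, [S_x, S_b]))"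
    using steps_if_word_steps by blast
  then show ?thesis
    by (force simp: halts_on_def)
qed

lemma halts_on_block_if_orbit_reaches_1:
  assumes "(T ^^ k) n = 1"
  shows "halts_on M3 Q_H (place i (block n ls))"
  using assms
proof (induction k arbitrary: n i ls)
  case 0
  then show ?case
    using halts_on_block_1 by simp
next
  case (Suc k)
  have T0: "(T ^^ l) 0 = 0" for l
    by (induction l) (auto simp: T_def)
  consider "n = 0" | "n = 1" | "n \<ge> 2" by linarith
  then show ?case
  proof cases
    case 1
    with Suc.prems T0[of "Suc k"] show ?thesis by (simp del: funpow.simps)
  next
    case 2
    then show ?thesis
      using halts_on_block_1 by simp
  next
    case 3
    then obtain ls' j where "(step M3)\<^sup>+\<^sup>+ (place i (block n ls)) (place j (block (T n) ls'))"
      using block_T proper_steps_if_proper_word_steps by meson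
    moreover have "halts_on M3 Q_H (place j (block (T n) ls'))"
      using Suc by (simp add: funpow_swap1)
    ultimately show ?thesis
      unfolding halts_on_def by (meson rtranclp_trans tranclp_into_rtranclp)
  qed
qed

text \<open>
  The induction runs along the halting computation. It needs the general statement about every
  configuration \<open>c\<close> that still has a block ahead of it: most configurations between two blocks are
  not blocks themselves. When \<open>c\<close> is itself the block, and longer
  than one cell, determinism puts the next block ahead of the successor of \<open>c\<close>.
\<close>

lemma orbit_reaches_1_if_halting:
  assumes "(step M3)\<^sup>*\<^sup>* c d" "config_state d = Q_H"
    and "(step M3)\<^sup>*\<^sup>* c (place i (block n ls))" "n > 0"
  shows "\<exists>k. (T ^^ k) n = 1"
  using assms(1,3,4)
proof (induction arbitrary: i n ls rule: converse_rtranclp_induct)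
  case base
  then have "d = place i (block n ls)"
    using assms(2) halted_is_final by (meson converse_rtranclpE)
  with assms(2) show ?case by simp
next
  case (step c c')
  have ahead: "(step M3)\<^sup>*\<^sup>* c' e" if "(step M3)\<^sup>+\<^sup>+ c e" for e
    using that step.hyps(1) step_deterministic by (metis tranclpD)
  consider "n = 1" | "c \<noteq> place i (block n ls)" | "n \<ge> 2" "c = place i (block n ls)"
    using \<open>n > 0\<close> by linarith
  then show ?case
  proof cases
    case 1
    then have "(T ^^ 0) n = 1" by simp
    then show ?thesis ..
  next
    case 2
    with step.prems ahead step.IH show ?thesis by (metis rtranclpD)
  next
    case 3
    then obtain ls' j where "(step M3)\<^sup>+\<^sup>+ c (place j (block (T n) ls'))"
      using block_T proper_steps_if_proper_word_steps by meson
    moreover have "T n > 0"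
      using \<open>n \<ge> 2\<close> by (auto simp: T_def)
    ultimately obtain k where "(T ^^ k) (T n) = 1"
      using ahead step.IH by blast
    then have "(T ^^ Suc k) n = 1"
      by (simp add: funpow_swap1)
    then show ?thesis ..
  qed
qed

lemma initial_config_block: "initial_config n = place 0 (block n [])"
  by (auto simp: initial_config_def blank_padded_def fun_eq_iff nth_Cons')

lemma three_x_plus_one_conjecture_iff_orbits_reach_1:
  "three_x_plus_one_conjecture \<longleftrightarrow> (\<forall>n>0. \<exists>k. (T ^^ k) n = 1)"
proof -
  have "\<exists>k. (T ^^ k) n = 1" if "(T ^^ j) n \<in> {1, 2}" for j n
  proof (cases "(T ^^ j) n = 1")
    case False
    with that have "(T ^^ Suc j) n = 1"
      by (simp add: T_def)
    then show ?thesis ..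
  qed blast
  then show ?thesis
    unfolding three_x_plus_one_conjecture_def by blast
qed

theorem theorem5p1:
  shows "three_x_plus_one_conjecture \<longleftrightarrow>
    (\<forall>n::nat. n > 0 \<longrightarrow> halts_on M3 Q_H (initial_config n))"
proof -
  have "(\<exists>k. (T ^^ k) n = 1) \<longleftrightarrow> halts_on M3 Q_H (initial_config n)" if "n > 0" for n
    unfolding initial_config_block
  proof
    assume "halts_on M3 Q_H (place 0 (block n []))"
    then show "\<exists>k. (T ^^ k) n = 1"
      using orbit_reaches_1_if_halting[OF _ _ rtranclp.rtrancl_refl that]
      unfolding halts_on_def by blast
  qed (use halts_on_block_if_orbit_reaches_1 in blast)
  then show ?thesis
    unfolding three_x_plus_one_conjecture_iff_orbits_reach_1 by blast
qed

end
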